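(* For every energy model $\mathcal{M}$ admitting a polynomial-size, polynomial-time computable set of candidate energy levels (see context), there exist polynomial-time Turing reductions: from $\mathrm{dMFE}$ to $\mathrm{MFE}$, from $\mathrm{dPF}$ to $\mathrm{PF}$, from $\mathrm{MFE}$ to $\mathrm{dMFE}$, from $\mathrm{MFE}$ to $\#\mathrm{SSEL}$, and from $\mathrm{PF}$ to $\#\mathrm{SSEL}$.
   Context: A nucleic acid strand is a word over $\{A,C,G,T\}$ (or with $U$ for RNA); an input may be a single strand or a multiset of strands, with $n$ the total number of bases. A secondary structure is a set of base pairs between complementary bases ($A$–$T$, $C$–$G$) in which each base occurs in at most one pair. $\Omega_s$ denotes the set of secondary structures under interest of $s$ (e.g. all, or only unpseudoknotted ones). An energy model $\mathcal{M}$ assigns to each $S\in\Omega_s$ and temperature $T>0$ a free energy $\Delta G^{\mathcal{M}}(S,T)\in\mathbb{R}$. Problems (inputs $s$, $T$, $\mathcal{M}$, and where relevant $k\in\mathbb{R}$): MFE outputs $\min_{S\in\Omega_s}\Delta G^{\mathcal{M}}(S,T)$; PF outputs $\sum_{S\in\Omega_s}e^{-\Delta G^{\mathcal{M}}(S,T)/k_BT}$; dMFE decides whether $\mathrm{MFE}(s,T,\mathcal{M})\le k$; dPF decides whether $\mathrm{PF}(s,T,\mathcal{M})\ge k$; $\#\mathrm{SSEL}$ outputs the number of $S\in\Omega_s$ with $\Delta G^{\mathcal{M}}(S)=k$. A set of candidate energy levels $\mathcal{G}_s^{\mathcal{M}}$ is a finite superset of $\{\Delta G^{\mathcal{M}}(S):S\in\Omega_s\}$;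 standing assumption: such a set exists of size polynomial in $n$, computable in polynomial time, consisting of rational numbers with $O(\log n)$-digit precision. A polynomial-time Turing reduction from $A$ to $B$ is an algorithm solving $A$ with polynomially many calls to an oracle for $B$ and polynomial time outside those calls. *)

theory Defs
  imports Complex_Main "HOL-Library.Disjoint_Sets"
begin

section \<open>Strands, secondary structures, energy models\<close>

text \<open>For RNA, \<open>Thy\<close> stands for the letter U.\<close>

datatype base = Ade | Cyt | Gua | Thy

text \<open>A multiset of strands is written down as a list; a single strand is a one-element list.
  No invariance under reordering the list is imposed on anything below.\<close>

type_synonym strands = "base list list"

definition inputs :: "strands set" where
  "inputs = {s. s \<noteq> [] \<and> [] \<notin> set s}"

definition num_bases :: "strands \<Rightarrow> nat" where
  "num_bases s = sum_list (map length s)"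

text \<open>The site \<open>(i, j)\<close> is the \<open>j\<close>-th base of the \<open>i\<close>-th strand.\<close>

type_synonym site = "nat \<times> nat"

definition sites :: "strands \<Rightarrow> site set" where
  "sites s = {(i, j). i < length s \<and> j < length (s ! i)}"

definition base_at :: "strands \<Rightarrow> site \<Rightarrow> base" where
  "base_at s p = s ! fst p ! snd p"

definition complementary :: "base \<Rightarrow> base \<Rightarrow> bool" where
  "complementary a b \<longleftrightarrow> {a, b} = {Ade, Thy} \<or> {a, b} = {Cyt, Gua}"

type_synonym sstructure = "site set set"

definition secondary_structures :: "strands \<Rightarrow> sstructure set" where
  "secondary_structures s =
     {S. (\<forall>e\<in>S. \<exists>p\<in>sites s. \<exists>q\<in>sites s.
            e = {p, q} \<and> complementary (base_at s p) (base_at s q)) \<and> disjoint S}"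

text \<open>The structures under interest; nonemptiness is what makes the minimum free energy exist.\<close>

definition structures_of_interest :: "(strands \<Rightarrow> sstructure set) \<Rightarrow> bool" where
  "structures_of_interest \<Omega> \<longleftrightarrow>
     (\<forall>s\<in>inputs. \<Omega> s \<subseteq> secondary_structures s \<and> \<Omega> s \<noteq> {})"

text \<open>\<open>M s S T\<close> is the free energy of the structure \<open>S\<close> of \<open>s\<close> at temperature \<open>T\<close>.\<close>

type_synonym energy_model = "strands \<Rightarrow> sstructure \<Rightarrow> real \<Rightarrow> real"

definition mfe :: "(strands \<Rightarrow> sstructure set) \<Rightarrow> energy_model \<Rightarrow> strands \<Rightarrow> real \<Rightarrow> real" where
  "mfe \<Omega> M s T = Min ((\<lambda>S. M s S T) ` \<Omega> s)"

definition pf ::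
  "real \<Rightarrow> (strands \<Rightarrow> sstructure set) \<Rightarrow> energy_model \<Rightarrow> strands \<Rightarrow> real \<Rightarrow> real" where
  "pf kB \<Omega> M s T = (\<Sum>S\<in>\<Omega> s. exp (- M s S T / (kB * T)))"

definition num_ssel ::
  "(strands \<Rightarrow> sstructure set) \<Rightarrow> energy_model \<Rightarrow> strands \<Rightarrow> real \<Rightarrow> real \<Rightarrow> nat" where
  "num_ssel \<Omega> M s T k = card {S \<in> \<Omega> s. M s S T = k}"


section \<open>Oracle programs\<close>

text \<open>
  The model of computation is the language of while-programs over binary trees (Jones), whose
  polynomial-time computable functions on trees without numbers are those of Turing machines,
  extended by real numbers as a further kind of leaf, since some inputs and outputs of the problems
  considered are real numbers. Real numbers are handled exactly, but not at unit cost: at run time a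
  number is a pair \<open>(r, l)\<close> of its value and the size \<open>l\<close> of the arithmetic expression by which it
  was obtained from input numbers, oracle answers and constants, and an operation is charged with
  this size. Hence, e.g., repeated squaring takes exponential time.
\<close>

datatype 'a data = Leaf | Pair "'a data" "'a data" | Num 'a

type_synonym val = "(real \<times> nat) data"

fun vsize :: "val \<Rightarrow> nat" where
  "vsize Leaf = 1"
| "vsize (Pair u v) = 1 + vsize u + vsize v"
| "vsize (Num x) = snd x"

definition load :: "real data \<Rightarrow> val" where
  "load = map_data (\<lambda>r. (r, 1))"

definition strip :: "val \<Rightarrow> real data" where
  "strip = map_data fst"

fun hd_val :: "val \<Rightarrow> val" where
  "hd_val (Pair u v) = u"
| "hd_val _ = Leaf"

fun tl_val :: "val \<Rightarrow> val" where
  "tl_val (Pair u v) = v"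
| "tl_val _ = Leaf"

fun is_pair :: "val \<Rightarrow> bool" where
  "is_pair (Pair u v) = True"
| "is_pair _ = False"

fun num_of :: "val \<Rightarrow> real \<times> nat" where
  "num_of (Num x) = x"
| "num_of _ = (0, 1)"

datatype aop = Add | Sub | Mul | Div

fun aop_fun :: "aop \<Rightarrow> real \<Rightarrow> real \<Rightarrow> real" where
  "aop_fun Add = (+)"
| "aop_fun Sub = (-)"
| "aop_fun Mul = (*)"
| "aop_fun Div = (/)"

type_synonym var = nat

text \<open>In each assignment the first variable is the target. \<open>LoadKB\<close> makes the Boltzmann
  constant available, the only constant besides the integers. \<open>Call x c y\<close> runs the
  subroutine \<open>c\<close> in a fresh store on the value of \<open>y\<close> and stores its result in \<open>x\<close>.\<close>

datatype com =
    Skip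
  | SetLeaf var
  | Copy var var
  | MkPair var var var
  | Head var var
  | Tail var var
  | Const var int
  | LoadKB var
  | Arith aop var var var
  | ExpOf var var
  | Seq com com
  | IfPair var com com
  | IfLe var var com com
  | While var com
  | Call var com var
  | Oracle var var

type_synonym store = "var \<Rightarrow> val"

definition init :: "val \<Rightarrow> store" where
  "init v = (\<lambda>_. Leaf)(0 := v)"

text \<open>\<open>exec kB Q c s t s'\<close>: with oracle \<open>Q\<close>, the program \<open>c\<close> takes the store \<open>s\<close> to the
  store \<open>s'\<close> in time \<open>t\<close>. An oracle call is charged with writing the query and
  reading the answer. The oracle only sees the values of the numbers in the query.\<close>

inductive exec ::
  "real \<Rightarrow> (real data \<Rightarrow> real data) \<Rightarrow> com \<Rightarrow> store \<Rightarrow> nat \<Rightarrow> store \<Rightarrow> bool"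
  for kB :: real and Q :: "real data \<Rightarrow> real data" where
  Skip: "exec kB Q Skip s 1 s"
| SetLeaf: "exec kB Q (SetLeaf x) s 1 (s(x := Leaf))"
| Copy: "exec kB Q (Copy x y) s 1 (s(x := s y))"
| MkPair: "exec kB Q (MkPair x y z) s 1 (s(x := Pair (s y) (s z)))"
| Head: "exec kB Q (Head x y) s 1 (s(x := hd_val (s y)))"
| Tail: "exec kB Q (Tail x y) s 1 (s(x := tl_val (s y)))"
| Const: "exec kB Q (Const x i) s 1 (s(x := Num (of_int i, 1)))"
| LoadKB: "exec kB Q (LoadKB x) s 1 (s(x := Num (kB, 1)))"
| Arith: "num_of (s y) = (a, k) \<Longrightarrow> num_of (s z) = (b, l) \<Longrightarrow>
    exec kB Q (Arith f x y z) s (1 + k + l) (s(x := Num (aop_fun f a b, 1 + k + l)))"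
| ExpOf: "num_of (s y) = (a, k) \<Longrightarrow>
    exec kB Q (ExpOf x y) s (1 + k) (s(x := Num (exp a, 1 + k)))"
| Seq: "exec kB Q c s t s' \<Longrightarrow> exec kB Q d s' u s'' \<Longrightarrow>
    exec kB Q (Seq c d) s (t + u) s''"
| IfPairTrue: "is_pair (s x) \<Longrightarrow> exec kB Q c s t s' \<Longrightarrow>
    exec kB Q (IfPair x c d) s (1 + t) s'"
| IfPairFalse: "\<not> is_pair (s x) \<Longrightarrow> exec kB Q d s t s' \<Longrightarrow>
    exec kB Q (IfPair x c d) s (1 + t) s'"
| IfLeTrue: "num_of (s x) = (a, k) \<Longrightarrow> num_of (s y) = (b, l) \<Longrightarrow> a \<le> b \<Longrightarrow>
    exec kB Q c s t s' \<Longrightarrow> exec kB Q (IfLe x y c d) s (1 + k + l + t) s'"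
| IfLeFalse: "num_of (s x) = (a, k) \<Longrightarrow> num_of (s y) = (b, l) \<Longrightarrow> \<not> a \<le> b \<Longrightarrow>
    exec kB Q d s t s' \<Longrightarrow> exec kB Q (IfLe x y c d) s (1 + k + l + t) s'"
| WhileFalse: "\<not> is_pair (s x) \<Longrightarrow> exec kB Q (While x c) s 1 s"
| WhileTrue: "is_pair (s x) \<Longrightarrow> exec kB Q c s t s' \<Longrightarrow> exec kB Q (While x c) s' u s'' \<Longrightarrow>
    exec kB Q (While x c) s (1 + t + u) s''"
| Call: "exec kB Q c (init (s y)) t s' \<Longrightarrow>
    exec kB Q (Call x c y) s (1 + t) (s(x := s' 0))"
| Oracle: "v = load (Q (strip (s y))) \<Longrightarrow>
    exec kB Q (Oracle x y) s (1 + vsize (s y) + vsize v) (s(x := v))"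

primrec oracle_free :: "com \<Rightarrow> bool" where
  "oracle_free Skip = True"
| "oracle_free (SetLeaf x) = True"
| "oracle_free (Copy x y) = True"
| "oracle_free (MkPair x y z) = True"
| "oracle_free (Head x y) = True"
| "oracle_free (Tail x y) = True"
| "oracle_free (Const x i) = True"
| "oracle_free (LoadKB x) = True"
| "oracle_free (Arith f x y z) = True"
| "oracle_free (ExpOf x y) = True"
| "oracle_free (Seq c d) = (oracle_free c \<and> oracle_free d)"
| "oracle_free (IfPair x c d) = (oracle_free c \<and> oracle_free d)"
| "oracle_free (IfLe x y c d) = (oracle_free c \<and> oracle_free d)"
| "oracle_free (While x c) = oracle_free c"
| "oracle_free (Call x c y) = oracle_free c"
| "oracle_free (Oracle x y) = False"


section \<open>Problems and polynomial-time Turing reductions\<close>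

text \<open>A problem relates each of its instances to the correct outputs; data outside the domain
  are not instances.\<close>

type_synonym problem = "(real data \<times> real data) set"

definition oracle_for :: "(real data \<Rightarrow> real data) \<Rightarrow> problem \<Rightarrow> bool" where
  "oracle_for Q B \<longleftrightarrow> (\<forall>x\<in>Domain B. (x, Q x) \<in> B)"

text \<open>The time includes writing the output.\<close>

definition solves_in_time ::
  "real \<Rightarrow> (real data \<Rightarrow> real data) \<Rightarrow> com \<Rightarrow> problem \<Rightarrow> (nat \<Rightarrow> nat) \<Rightarrow> bool" where
  "solves_in_time kB Q c A f \<longleftrightarrow>
     (\<forall>x\<in>Domain A. \<exists>t s'. exec kB Q c (init (load x)) t s' \<and> (x, strip (s' 0)) \<in> A \<and>
        t + vsize (s' 0) \<le> f (vsize (load x)))"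

definition poly_bounded :: "(nat \<Rightarrow> nat) \<Rightarrow> bool" where
  "poly_bounded f \<longleftrightarrow> (\<exists>a d. \<forall>n. f n \<le> a * n ^ d + a)"

definition poly_time_computable :: "real \<Rightarrow> problem \<Rightarrow> bool" where
  "poly_time_computable kB A \<longleftrightarrow>
     (\<exists>c f. oracle_free c \<and> poly_bounded f \<and> (\<forall>Q. solves_in_time kB Q c A f))"

definition poly_time_turing_reduction :: "real \<Rightarrow> problem \<Rightarrow> problem \<Rightarrow> bool" where
  "poly_time_turing_reduction kB A B \<longleftrightarrow>
     (\<exists>c f. poly_bounded f \<and> (\<forall>Q. oracle_for Q B \<longrightarrow> solves_in_time kB Q c A f))"


section \<open>The problems\<close>

fun enc_list :: "real data list \<Rightarrow> real data" where
  "enc_list [] = Leaf"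
| "enc_list (x # xs) = Pair x (enc_list xs)"

fun enc_base :: "base \<Rightarrow> real data" where
  "enc_base Ade = Leaf"
| "enc_base Cyt = Pair Leaf Leaf"
| "enc_base Gua = Pair Leaf (Pair Leaf Leaf)"
| "enc_base Thy = Pair (Pair Leaf Leaf) Leaf"

definition enc_strands :: "strands \<Rightarrow> real data" where
  "enc_strands s = enc_list (map (enc_list \<circ> map enc_base) s)"

definition enc_bool :: "bool \<Rightarrow> real data" where
  "enc_bool b = (if b then Pair Leaf Leaf else Leaf)"

definition inst :: "strands \<Rightarrow> real \<Rightarrow> real data" where
  "inst s T = Pair (enc_strands s) (Num T)"

definition inst_k :: "strands \<Rightarrow> real \<Rightarrow> real \<Rightarrow> real data" where
  "inst_k s T k = Pair (Num k) (inst s T)"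

text \<open>\<open>\<T>\<close> is the set of temperatures that may occur in an instance.\<close>

definition MFE :: "real set \<Rightarrow> (strands \<Rightarrow> sstructure set) \<Rightarrow> energy_model \<Rightarrow> problem" where
  "MFE \<T> \<Omega> M = {(inst s T, Num (mfe \<Omega> M s T)) | s T. s \<in> inputs \<and> T \<in> \<T>}"

definition PF ::
  "real \<Rightarrow> real set \<Rightarrow> (strands \<Rightarrow> sstructure set) \<Rightarrow> energy_model \<Rightarrow> problem" where
  "PF kB \<T> \<Omega> M = {(inst s T, Num (pf kB \<Omega> M s T)) | s T. s \<in> inputs \<and> T \<in> \<T>}"

definition dMFE :: "real set \<Rightarrow> (strands \<Rightarrow> sstructure set) \<Rightarrow> energy_model \<Rightarrow> problem" where
  "dMFE \<T> \<Omega> M =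
     {(inst_k s T k, enc_bool (mfe \<Omega> M s T \<le> k)) | s T k. s \<in> inputs \<and> T \<in> \<T>}"

definition dPF ::
  "real \<Rightarrow> real set \<Rightarrow> (strands \<Rightarrow> sstructure set) \<Rightarrow> energy_model \<Rightarrow> problem" where
  "dPF kB \<T> \<Omega> M =
     {(inst_k s T k, enc_bool (pf kB \<Omega> M s T \<ge> k)) | s T k. s \<in> inputs \<and> T \<in> \<T>}"

definition SSEL :: "real set \<Rightarrow> (strands \<Rightarrow> sstructure set) \<Rightarrow> energy_model \<Rightarrow> problem" where
  "SSEL \<T> \<Omega> M =
     {(inst_k s T k, Num (real (num_ssel \<Omega> M s T k))) | s T k. s \<in> inputs \<and> T \<in> \<T>}"


section \<open>Candidate energy levels\<close>

definition candidate_levels ::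
  "real set \<Rightarrow> (strands \<Rightarrow> sstructure set) \<Rightarrow> energy_model \<Rightarrow>
    (strands \<Rightarrow> real \<Rightarrow> real set) \<Rightarrow> bool" where
  "candidate_levels \<T> \<Omega> M G \<longleftrightarrow>
     (\<forall>s\<in>inputs. \<forall>T\<in>\<T>. finite (G s T) \<and> (\<lambda>S. M s S T) ` \<Omega> s \<subseteq> G s T)"

definition poly_size_levels :: "real set \<Rightarrow> (strands \<Rightarrow> real \<Rightarrow> real set) \<Rightarrow> bool" where
  "poly_size_levels \<T> G \<longleftrightarrow>
     (\<exists>f. poly_bounded f \<and> (\<forall>s\<in>inputs. \<forall>T\<in>\<T>. card (G s T) \<le> f (num_bases s)))"

text \<open>The output is a list of the levels, in any order and possibly with repetitions.\<close>

definition levels_problem :: "real set \<Rightarrow> (strands \<Rightarrow> real \<Rightarrow> real set) \<Rightarrow> problem" where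
  "levels_problem \<T> G =
     {(inst s T, enc_list (map Num xs)) | s T xs. s \<in> inputs \<and> T \<in> \<T> \<and> set xs = G s T}"

text \<open>Rational numbers with \<open>d = O(log n)\<close> digits of precision. Bounding only the denominator
  by \<open>10 ^ d\<close> covers both decimal fractions with \<open>d\<close> digits after the point and fractions
  whose numerator and denominator have at most \<open>d\<close> digits.\<close>

definition log_precision_levels :: "real set \<Rightarrow> (strands \<Rightarrow> real \<Rightarrow> real set) \<Rightarrow> bool" where
  "log_precision_levels \<T> G \<longleftrightarrow>
     (\<forall>T\<in>\<T>. \<exists>C. \<forall>s\<in>inputs. \<forall>g\<in>G s T. \<exists>(p::int) (q::nat) (d::nat).
        g = of_int p / of_nat q \<and> 0 < q \<and> q \<le> 10 ^ d \<and>
        real d \<le> C * (1 + ln (real (num_bases s))))"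

definition admits_candidate_levels ::
  "real \<Rightarrow> real set \<Rightarrow> (strands \<Rightarrow> sstructure set) \<Rightarrow> energy_model \<Rightarrow> bool" where
  "admits_candidate_levels kB \<T> \<Omega> M \<longleftrightarrow>
     (\<exists>G. candidate_levels \<T> \<Omega> M G \<and> poly_size_levels \<T> G \<and>
          poly_time_computable kB (levels_problem \<T> G) \<and> log_precision_levels \<T> G)"

end

theory Submission
  imports Defs
begin

text \<open>
  The decision problems are answered by one oracle call and one comparison. Conversely, a scan
  through the candidate levels, with one oracle call per level, finds the minimum free energy: it is
  the least level \<open>g\<close> for which the answer to dMFE is positive, and also the least level occupied
  by a structure. Grouping the structures by their energy gives
  \<open>PF = (\<Sum>g. #SSEL(g) * exp (- g / (kB * T)))\<close>, summed over the distinct candidate levels. The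
  size of the expression accumulated for this sum stays linear in the size of the list of levels.
\<close>

section \<open>Execution with postconditions\<close>

definition runs ::
  "real \<Rightarrow> (real data \<Rightarrow> real data) \<Rightarrow> com \<Rightarrow> store \<Rightarrow> (nat \<Rightarrow> store \<Rightarrow> bool) \<Rightarrow> bool" where
  "runs kB Q c s P \<longleftrightarrow> (\<exists>t s'. exec kB Q c s t s' \<and> P t s')"

inductive_simps exec_command_simps:
  "exec kB Q Skip s t s'"
  "exec kB Q (SetLeaf x) s t s'"
  "exec kB Q (Copy x y) s t s'"
  "exec kB Q (MkPair x y z) s t s'"
  "exec kB Q (Head x y) s t s'"
  "exec kB Q (Tail x y) s t s'"
  "exec kB Q (Const x i) s t s'"
  "exec kB Q (LoadKB x) s t s'"
  "exec kB Q (Arith f x y z) s t s'"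
  "exec kB Q (ExpOf x y) s t s'"
  "exec kB Q (Seq c d) s t s'"
  "exec kB Q (IfPair x c d) s t s'"
  "exec kB Q (IfLe x y c d) s t s'"
  "exec kB Q (Call x c y) s t s'"
  "exec kB Q (Oracle x y) s t s'"

lemma runs_mono:
  assumes "runs kB Q c s P" and "\<And>t s'. P t s' \<Longrightarrow> P' t s'"
  shows "runs kB Q c s P'"
  using assms unfolding runs_def by blast

lemma runs_atomic [simp]:
  "runs kB Q Skip s P = P 1 s"
  "runs kB Q (SetLeaf x) s P = P 1 (s(x := Leaf))"
  "runs kB Q (Copy x y) s P = P 1 (s(x := s y))"
  "runs kB Q (MkPair x y z) s P = P 1 (s(x := Pair (s y) (s z)))"
  "runs kB Q (Head x y) s P = P 1 (s(x := hd_val (s y)))"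
  "runs kB Q (Tail x y) s P = P 1 (s(x := tl_val (s y)))"
  "runs kB Q (Const x i) s P = P 1 (s(x := Num (of_int i, 1)))"
  "runs kB Q (LoadKB x) s P = P 1 (s(x := Num (kB, 1)))"
  by (simp_all add: runs_def exec_command_simps)

lemma runs_Arith [simp]:
  "runs kB Q (Arith f x y z) s P =
     P (1 + snd (num_of (s y)) + snd (num_of (s z)))
       (s(x := Num (aop_fun f (fst (num_of (s y))) (fst (num_of (s z))),
          1 + snd (num_of (s y)) + snd (num_of (s z)))))"
  by (cases "num_of (s y)"; cases "num_of (s z)") (simp add: runs_def exec_command_simps)

lemma runs_ExpOf [simp]:
  "runs kB Q (ExpOf x y) s P =
     P (1 + snd (num_of (s y))) (s(x := Num (exp (fst (num_of (s y))), 1 + snd (num_of (s y)))))"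
  by (cases "num_of (s y)") (simp add: runs_def exec_command_simps)

lemma runs_Seq [simp]:
  "runs kB Q (Seq c d) s P = runs kB Q c s (\<lambda>t s'. runs kB Q d s' (\<lambda>u. P (t + u)))"
  unfolding runs_def exec_command_simps by blast

lemma runs_IfPair [simp]:
  "runs kB Q (IfPair x c d) s P =
     (if is_pair (s x) then runs kB Q c s (\<lambda>t. P (1 + t)) else runs kB Q d s (\<lambda>t. P (1 + t)))"
  by (cases "is_pair (s x)") (auto simp: runs_def exec_command_simps)

lemma runs_IfLe [simp]:
  "runs kB Q (IfLe x y c d) s P =
     (if fst (num_of (s x)) \<le> fst (num_of (s y))
      then runs kB Q c s (\<lambda>t. P (1 + snd (num_of (s x)) + snd (num_of (s y)) + t))
      else runs kB Q d s (\<lambda>t. P (1 + snd (num_of (s x)) + snd (num_of (s y)) + t)))"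
  by (cases "num_of (s x)"; cases "num_of (s y)") (auto simp: runs_def exec_command_simps)

lemma runs_Call [simp]:
  "runs kB Q (Call x c y) s P = runs kB Q c (init (s y)) (\<lambda>t s'. P (1 + t) (s(x := s' 0)))"
  by (auto simp: runs_def exec_command_simps)

lemma runs_Oracle [simp]:
  "runs kB Q (Oracle x y) s P =
     P (1 + vsize (s y) + vsize (load (Q (strip (s y))))) (s(x := load (Q (strip (s y)))))"
  by (simp add: runs_def exec_command_simps)

lemma runs_While:
  assumes step: "\<And>s. I s \<Longrightarrow> is_pair (s x) \<Longrightarrow>
      runs kB Q c s (\<lambda>t s'. t \<le> B \<and> I s' \<and> vsize (s' x) < vsize (s x))"
    and "I s"
  shows "runs kB Q (While x c) s
      (\<lambda>t s'. t \<le> 1 + vsize (s x) * (B + 1) \<and> I s' \<and> \<not> is_pair (s' x))"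
  using \<open>I s\<close>
proof (induction "vsize (s x)" arbitrary: s rule: less_induct)
  case less
  show ?case
  proof (cases "is_pair (s x)")
    case False
    then have "exec kB Q (While x c) s 1 s"
      by (rule exec.WhileFalse)
    with False less.prems show ?thesis
      unfolding runs_def by (intro exI[of _ 1] exI[of _ s]) auto
  next
    case True
    from step[OF less.prems this] obtain t s' where
      c: "exec kB Q c s t s'" "t \<le> B" "I s'" and dec: "vsize (s' x) < vsize (s x)"
      unfolding runs_def by blast
    from less.hyps[OF dec \<open>I s'\<close>] obtain u s'' where
      w: "exec kB Q (While x c) s' u s''" "u \<le> 1 + vsize (s' x) * (B + 1)"
         "I s''" "\<not> is_pair (s'' x)"
      unfolding runs_def by blast
    have "(vsize (s' x) + 1) * (B + 1) \<le> vsize (s x) * (B + 1)"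
      using dec by (intro mult_right_mono) auto
    then have "1 + t + u \<le> 1 + vsize (s x) * (B + 1)"
      using c(2) w(2) by (simp add: algebra_simps)
    moreover have "exec kB Q (While x c) s (1 + t + u) s''"
      using True c(1) w(1) by (rule exec.WhileTrue)
    ultimately show ?thesis
      unfolding runs_def using w(3,4) by blast
  qed
qed

lemma init_simps [simp]: "init v 0 = v" "x \<noteq> 0 \<Longrightarrow> init v x = Leaf"
  by (auto simp: init_def)

section \<open>Encodings\<close>

lemma strip_simps [simp]:
  "strip Leaf = Leaf" "strip (Pair u v) = Pair (strip u) (strip v)" "strip (Num x) = Num (fst x)"
  by (simp_all add: strip_def)

lemma load_simps [simp]:
  "load Leaf = Leaf" "load (Pair u v) = Pair (load u) (load v)" "load (Num r) = Num (r, 1)"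
  by (simp_all add: load_def)

lemma strip_load [simp]: "strip (load x) = x"
  by (induction x) auto

lemma vsize_load_enc_bool: "vsize (load (enc_bool b)) \<le> 3"
  by (simp add: enc_bool_def)

lemma is_pair_load_enc_bool [simp]: "is_pair (load (enc_bool b)) = b"
  by (simp add: enc_bool_def)

lemma strip_is_pairE:
  assumes "strip v = enc_list (map Num xs)" and "is_pair v"
  obtains g l w ys where "v = Pair (Num (g, l)) w" "xs = g # ys" "strip w = enc_list (map Num ys)"
proof -
  obtain u w where v: "v = Pair u w"
    using assms(2) by (cases v) auto
  with assms(1) obtain g ys where
    xs: "xs = g # ys" "strip u = Num g" "strip w = enc_list (map Num ys)"
    by (cases xs) auto
  obtain l where "u = Num (g, l)"
    using xs(2) by (cases u) auto
  with v xs that show thesis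
    by blast
qed

lemma strip_not_pair:
  assumes "strip v = enc_list (map Num xs)" and "\<not> is_pair v"
  shows "xs = []"
  using assms by (cases v; cases xs) auto

lemma enc_list_inject [simp]: "enc_list xs = enc_list ys \<longleftrightarrow> xs = ys"
proof (induction xs arbitrary: ys)
  case Nil
  then show ?case by (cases ys) auto
next
  case (Cons x xs)
  then show ?case by (cases ys) auto
qed

lemma inj_enc_base: "inj enc_base"
proof (rule injI)
  fix a b show "enc_base a = enc_base b \<Longrightarrow> a = b"
    by (cases a; cases b) auto
qed

lemma inj_enc_strands: "inj enc_strands"
proof -
  have "inj (enc_list \<circ> map enc_base)"
    by (rule inj_compose) (auto simp: inj_enc_base intro: injI)
  then show ?thesis
    by (auto simp: enc_strands_def inj_def dest: inj_mapD[THEN injD])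
qed

lemma inst_inject [simp]: "inst s T = inst s' T' \<longleftrightarrow> s = s' \<and> T = T'"
  using inj_enc_strands by (auto simp: inst_def inj_def)

lemma inst_k_inject [simp]: "inst_k s T k = inst_k s' T' k' \<longleftrightarrow> s = s' \<and> T = T' \<and> k = k'"
  by (auto simp: inst_k_def)

lemma strip_query:
  "strip (Pair (Num (k, l)) (load (inst s T))) = inst_k s T k"
  by (simp add: inst_k_def)

lemma oracle_MFE:
  assumes "oracle_for Q (MFE \<T> \<Omega> M)" "s \<in> inputs" "T \<in> \<T>"
  shows "Q (inst s T) = Num (mfe \<Omega> M s T)"
proof -
  have "inst s T \<in> Domain (MFE \<T> \<Omega> M)"
    using assms(2,3) by (auto simp: MFE_def)
  then have "(inst s T, Q (inst s T)) \<in> MFE \<T> \<Omega> M"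
    using assms(1) by (simp add: oracle_for_def)
  then show ?thesis
    by (auto simp: MFE_def)
qed

lemma oracle_PF:
  assumes "oracle_for Q (PF kB \<T> \<Omega> M)" "s \<in> inputs" "T \<in> \<T>"
  shows "Q (inst s T) = Num (pf kB \<Omega> M s T)"
proof -
  have "inst s T \<in> Domain (PF kB \<T> \<Omega> M)"
    using assms(2,3) by (auto simp: PF_def)
  then have "(inst s T, Q (inst s T)) \<in> PF kB \<T> \<Omega> M"
    using assms(1) by (simp add: oracle_for_def)
  then show ?thesis
    by (auto simp: PF_def)
qed

lemma oracle_dMFE:
  assumes "oracle_for Q (dMFE \<T> \<Omega> M)" "s \<in> inputs" "T \<in> \<T>"
  shows "Q (inst_k s T k) = enc_bool (mfe \<Omega> M s T \<le> k)"
proof -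
  have "inst_k s T k \<in> Domain (dMFE \<T> \<Omega> M)"
    using assms(2,3) unfolding dMFE_def by blast
  then have "(inst_k s T k, Q (inst_k s T k)) \<in> dMFE \<T> \<Omega> M"
    using assms(1) by (simp add: oracle_for_def)
  then show ?thesis
    by (auto simp: dMFE_def)
qed

lemma oracle_SSEL:
  assumes "oracle_for Q (SSEL \<T> \<Omega> M)" "s \<in> inputs" "T \<in> \<T>"
  shows "Q (inst_k s T k) = Num (real (num_ssel \<Omega> M s T k))"
proof -
  have "inst_k s T k \<in> Domain (SSEL \<T> \<Omega> M)"
    using assms(2,3) unfolding SSEL_def by blast
  then have "(inst_k s T k, Q (inst_k s T k)) \<in> SSEL \<T> \<Omega> M"
    using assms(1) by (simp add: oracle_for_def)
  then show ?thesis
    by (auto simp: SSEL_def)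
qed

section \<open>Polynomial bounds\<close>

lemma poly_bounded_const: "poly_bounded (\<lambda>_. k)"
  unfolding poly_bounded_def by (intro exI[of _ k] exI[of _ 0]) simp

lemma poly_bounded_id: "poly_bounded (\<lambda>n. n)"
  unfolding poly_bounded_def by (intro exI[of _ 1] exI[of _ 1]) simp

lemma power_le_Suc_power_add:
  fixes n d e :: nat
  shows "n ^ d \<le> n ^ (d + e) + 1"
proof (cases "n = 0")
  case False
  then have "n ^ d \<le> n ^ (d + e)"
    by (intro power_increasing) auto
  then show ?thesis by simp
qed (cases d; simp)

lemma poly_bounded_add:
  assumes "poly_bounded f" and "poly_bounded g"
  shows "poly_bounded (\<lambda>n. f n + g n)"
proof -
  obtain a d b e where f: "\<And>n. f n \<le> a * n ^ d + a" and g: "\<And>n. g n \<le> b * n ^ e + b"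
    using assms unfolding poly_bounded_def by blast
  have "f n + g n \<le> (2 * a + 2 * b) * n ^ (d + e) + (2 * a + 2 * b)" for n
  proof -
    have "a * n ^ d \<le> a * (n ^ (d + e) + 1)" "b * n ^ e \<le> b * (n ^ (d + e) + 1)"
      using power_le_Suc_power_add[of n d e] power_le_Suc_power_add[of n e d]
      unfolding add.commute[of e d] by (intro mult_left_mono; simp)+
    with f[of n] g[of n] show ?thesis
      by (simp add: algebra_simps)
  qed
  then show ?thesis
    unfolding poly_bounded_def by blast
qed

lemma poly_bounded_mult:
  assumes "poly_bounded f" and "poly_bounded g"
  shows "poly_bounded (\<lambda>n. f n * g n)"
proof -
  obtain a d b e where f: "\<And>n. f n \<le> a * n ^ d + a" and g: "\<And>n. g n \<le> b * n ^ e + b"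
    using assms unfolding poly_bounded_def by blast
  have "f n * g n \<le> (4 * (a * b)) * n ^ (d + e) + 4 * (a * b)" for n
  proof -
    have "f n * g n \<le> (a * n ^ d + a) * (b * n ^ e + b)"
      using f g by (intro mult_mono) auto
    also have "\<dots> = (a * b) * (n ^ (d + e) + n ^ d + n ^ e + 1)"
      by (simp add: algebra_simps power_add)
    also have "\<dots> \<le> (a * b) * (4 * n ^ (d + e) + 4)"
      using power_le_Suc_power_add[of n d e] power_le_Suc_power_add[of n e d]
      by (intro mult_left_mono) (auto simp: add.commute)
    finally show ?thesis
      by (simp add: algebra_simps)
  qed
  then show ?thesis
    unfolding poly_bounded_def by blast
qed

lemmas poly_bounded_intros =
  poly_bounded_const poly_bounded_id poly_bounded_add poly_bounded_mult

section \<open>Structures and levels\<close>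

lemma finite_secondary_structures: "finite (secondary_structures s)"
proof -
  have "sites s = (SIGMA i:{..<length s}. {..<length (s ! i)})"
    by (auto simp: sites_def)
  then have "finite (sites s)"
    by simp
  moreover have "secondary_structures s \<subseteq> Pow (Pow (sites s))"
    unfolding secondary_structures_def by fastforce
  ultimately show ?thesis
    by (metis finite_Pow_iff finite_subset)
qed

lemma finite_structures_of_interest:
  assumes "structures_of_interest \<Omega>" and "s \<in> inputs"
  shows "finite (\<Omega> s)" and "\<Omega> s \<noteq> {}"
  using assms finite_secondary_structures
  by (auto simp: structures_of_interest_def intro: finite_subset)

lemma num_ssel_pos_iff:
  assumes "finite (\<Omega> s)"
  shows "1 \<le> num_ssel \<Omega> M s T k \<longleftrightarrow> k \<in> (\<lambda>S. M s S T) ` \<Omega> s"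
proof -
  have "1 \<le> num_ssel \<Omega> M s T k \<longleftrightarrow> {S \<in> \<Omega> s. M s S T = k} \<noteq> {}"
    unfolding num_ssel_def using assms by (simp add: Suc_le_eq card_gt_0_iff)
  then show ?thesis
    by auto
qed

lemma pf_eq_sum_levels:
  assumes "finite (\<Omega> s)" and "finite G" and "(\<lambda>S. M s S T) ` \<Omega> s \<subseteq> G"
  shows "pf kB \<Omega> M s T = (\<Sum>g\<in>G. real (num_ssel \<Omega> M s T g) * exp (- g / (kB * T)))"
proof -
  have "pf kB \<Omega> M s T = (\<Sum>g\<in>G. \<Sum>S\<in>{S \<in> \<Omega> s. M s S T = g}. exp (- M s S T / (kB * T)))"
    unfolding pf_def by (rule sum.group[OF assms, symmetric])
  also have "\<dots> = (\<Sum>g\<in>G. real (num_ssel \<Omega> M s T g) * exp (- g / (kB * T)))"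
    by (rule sum.cong) (auto simp: num_ssel_def)
  finally show ?thesis .
qed

lemma levels_program:
  assumes "admits_candidate_levels kB \<T> \<Omega> M"
  obtains c h where "poly_bounded h"
    and "\<And>Q s T. s \<in> inputs \<Longrightarrow> T \<in> \<T> \<Longrightarrow>
      runs kB Q c (init (load (inst s T)))
        (\<lambda>t s'. t \<le> h (vsize (load (inst s T))) \<and> vsize (s' 0) \<le> h (vsize (load (inst s T))) \<and>
           (\<exists>xs. strip (s' 0) = enc_list (map Num xs) \<and> (\<lambda>S. M s S T) ` \<Omega> s \<subseteq> set xs))"
proof -
  obtain G c h where G: "candidate_levels \<T> \<Omega> M G" and h: "poly_bounded h"
    and c: "\<And>Q. solves_in_time kB Q c (levels_problem \<T> G) h"
    using assms unfolding admits_candidate_levels_def poly_time_computable_def by blast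
  show thesis
  proof (rule that[OF h])
    fix Q s T assume sT: "s \<in> inputs" "T \<in> \<T>"
    then have fin: "finite (G s T)" and sub: "(\<lambda>S. M s S T) ` \<Omega> s \<subseteq> G s T"
      using G by (auto simp: candidate_levels_def)
    obtain ys where "set ys = G s T"
      using finite_list[OF fin] by blast
    then have "inst s T \<in> Domain (levels_problem \<T> G)"
      using sT unfolding levels_problem_def by blast
    then obtain t s' where e: "exec kB Q c (init (load (inst s T))) t s'"
      and lp: "(inst s T, strip (s' 0)) \<in> levels_problem \<T> G"
      and b: "t + vsize (s' 0) \<le> h (vsize (load (inst s T)))"
      using c[of Q] unfolding solves_in_time_def by blast
    from lp obtain xs where "strip (s' 0) = enc_list (map Num xs)" "set xs = G s T"
      by (auto simp: levels_problem_def)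
    with e b sub show "runs kB Q c (init (load (inst s T)))
        (\<lambda>t s'. t \<le> h (vsize (load (inst s T))) \<and> vsize (s' 0) \<le> h (vsize (load (inst s T))) \<and>
           (\<exists>xs. strip (s' 0) = enc_list (map Num xs) \<and> (\<lambda>S. M s S T) ` \<Omega> s \<subseteq> set xs))"
      unfolding runs_def by (intro exI[of _ t] exI[of _ s']) auto
  qed
qed

section \<open>From decision to optimisation and counting\<close>

lemma dMFE_reduces_to_MFE:
  "poly_time_turing_reduction kB (dMFE \<T> \<Omega> M) (MFE \<T> \<Omega> M)"
proof -
  define c where "c = Seq (Head 1 0) (Seq (Tail 2 0) (Seq (Oracle 3 2)
    (IfLe 3 1 (Seq (SetLeaf 4) (MkPair 0 4 4)) (SetLeaf 0))))"
  have "solves_in_time kB Q c (dMFE \<T> \<Omega> M) (\<lambda>n. n + 20)" if Q: "oracle_for Q (MFE \<T> \<Omega> M)" for Q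
    unfolding solves_in_time_def runs_def[symmetric]
  proof
    fix x assume "x \<in> Domain (dMFE \<T> \<Omega> M)"
    then obtain s T k where x: "x = inst_k s T k" and sT: "s \<in> inputs" "T \<in> \<T>"
      by (auto simp: dMFE_def)
    have in_dMFE: "(x, d) \<in> dMFE \<T> \<Omega> M \<longleftrightarrow> d = enc_bool (mfe \<Omega> M s T \<le> k)" for d
      using sT unfolding x dMFE_def by auto
    show "runs kB Q c (init (load x))
      (\<lambda>t s'. (x, strip (s' 0)) \<in> dMFE \<T> \<Omega> M \<and> t + vsize (s' 0) \<le> vsize (load x) + 20)"
      unfolding in_dMFE by (simp add: c_def x inst_k_def oracle_MFE[OF Q sT] enc_bool_def)
  qed
  moreover have "poly_bounded (\<lambda>n. n + 20)"
    by (intro poly_bounded_intros)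
  ultimately show ?thesis
    unfolding poly_time_turing_reduction_def by blast
qed

lemma dPF_reduces_to_PF:
  "poly_time_turing_reduction kB (dPF kB \<T> \<Omega> M) (PF kB \<T> \<Omega> M)"
proof -
  define c where "c = Seq (Head 1 0) (Seq (Tail 2 0) (Seq (Oracle 3 2)
    (IfLe 1 3 (Seq (SetLeaf 4) (MkPair 0 4 4)) (SetLeaf 0))))"
  have "solves_in_time kB Q c (dPF kB \<T> \<Omega> M) (\<lambda>n. n + 20)"
    if Q: "oracle_for Q (PF kB \<T> \<Omega> M)" for Q
    unfolding solves_in_time_def runs_def[symmetric]
  proof
    fix x assume "x \<in> Domain (dPF kB \<T> \<Omega> M)"
    then obtain s T k where x: "x = inst_k s T k" and sT: "s \<in> inputs" "T \<in> \<T>"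
      by (auto simp: dPF_def)
    have in_dPF: "(x, d) \<in> dPF kB \<T> \<Omega> M \<longleftrightarrow> d = enc_bool (pf kB \<Omega> M s T \<ge> k)" for d
      using sT unfolding x dPF_def by auto
    show "runs kB Q c (init (load x))
      (\<lambda>t s'. (x, strip (s' 0)) \<in> dPF kB \<T> \<Omega> M \<and> t + vsize (s' 0) \<le> vsize (load x) + 20)"
      unfolding in_dPF by (simp add: c_def x inst_k_def oracle_PF[OF Q sT] enc_bool_def)
  qed
  moreover have "poly_bounded (\<lambda>n. n + 20)"
    by (intro poly_bounded_intros)
  ultimately show ?thesis
    unfolding poly_time_turing_reduction_def by blast
qed

section \<open>Scanning the levels for a minimum\<close>

text \<open>Variable 0 holds the instance, 1 the levels not yet scanned, and 2 a pair whose head is the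
  least accepted level so far (a leaf before the first one). The subroutine \<open>d\<close> accepts by
  returning a pair.\<close>

definition min_body :: "com \<Rightarrow> com" where
  "min_body d = Seq (Head 3 1) (Seq (Tail 1 1) (Seq (MkPair 4 3 0) (Seq (Call 5 d 4)
     (IfPair 5
       (IfPair 2 (Seq (Head 6 2) (IfLe 3 6 (MkPair 2 3 3) Skip)) (MkPair 2 3 3))
       Skip))))"

lemma runs_min_loop:
  assumes d: "\<And>g l. runs kB Q d (init (Pair (Num (g, l)) v))
      (\<lambda>t s'. is_pair (s' 0) = test g \<and> t \<le> l + K)"
    and L: "strip L = enc_list (map Num xs)"
    and m: "m \<in> set xs" "test m" "\<And>g. g \<in> set xs \<Longrightarrow> test g \<Longrightarrow> m \<le> g"
  shows "runs kB Q (Seq (While 1 (min_body d)) (Head 0 2)) ((init v)(1 := L))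
      (\<lambda>t s'. t \<le> 2 + vsize L * (3 * vsize L + K + 16) \<and> (\<exists>l \<le> vsize L. s' 0 = Num (m, l)))"
proof -
  define I :: "store \<Rightarrow> bool" where "I s \<longleftrightarrow> s 0 = v \<and> vsize (s 1) \<le> vsize L \<and>
    (\<exists>zs. strip (s 1) = enc_list (map Num zs) \<and> set zs \<subseteq> set xs \<and>
      (is_pair (s 2) \<longrightarrow> (\<exists>r l u. s 2 = Pair (Num (r, l)) u \<and> l \<le> vsize L \<and> test r \<and> r \<in> set xs)) \<and>
      (m \<in> set zs \<or> (\<exists>l u. s 2 = Pair (Num (m, l)) u)))" for s
  let ?B = "3 * vsize L + K + 15"
  have step: "runs kB Q (min_body d) s (\<lambda>t s'. t \<le> ?B \<and> I s' \<and> vsize (s' 1) < vsize (s 1))"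
    if "I s" "is_pair (s 1)" for s
  proof -
    from \<open>I s\<close> obtain zs where s0: "s 0 = v" and vs: "vsize (s 1) \<le> vsize L"
      and zs: "strip (s 1) = enc_list (map Num zs)" "set zs \<subseteq> set xs"
      and best: "is_pair (s 2) \<Longrightarrow>
        \<exists>r l u. s 2 = Pair (Num (r, l)) u \<and> l \<le> vsize L \<and> test r \<and> r \<in> set xs"
      and pend: "m \<in> set zs \<or> (\<exists>l u. s 2 = Pair (Num (m, l)) u)"
      unfolding I_def by blast
    from strip_is_pairE[OF zs(1) \<open>is_pair (s 1)\<close>] obtain g l w ys where
      g: "s 1 = Pair (Num (g, l)) w" "zs = g # ys" "strip w = enc_list (map Num ys)" .
    have gx: "g \<in> set xs" "set ys \<subseteq> set xs" and sz: "1 + l + vsize w \<le> vsize L"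
      using zs(2) vs g by auto
    show ?thesis
    proof (cases "is_pair (s 2)")
      case True
      from best[OF this] obtain r k u where
        r: "s 2 = Pair (Num (r, k)) u" "k \<le> vsize L" "test r" "r \<in> set xs" by blast
      show ?thesis
        unfolding min_body_def using g(1) r(1) s0
        apply simp
        apply (rule runs_mono[OF d])
        using sz r m(2) pend gx g m(3)[of g] m(3)[of r]
        apply (auto simp: I_def)
        done
    next
      case False
      with pend have "m \<in> set zs" by auto
      then show ?thesis
        unfolding min_body_def using g(1) False s0
        apply simp
        apply (rule runs_mono[OF d])
        using sz m(2) gx g m(3)[of g]
        apply (auto simp: I_def)
        done
    qed
  qed
  have start: "I ((init v)(1 := L))"
    using L m(1) by (auto simp: I_def)
  show ?thesis
    unfolding runs_Seq
  proof (rule runs_mono[OF runs_While[where I = I and B = ?B]], rule step, assumption, assumption,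
      rule start)
    fix t s'
    assume A: "t \<le> 1 + vsize (((init v)(1 := L)) 1) * (?B + 1) \<and> I s' \<and> \<not> is_pair (s' 1)"
    then obtain zs where zs: "strip (s' 1) = enc_list (map Num zs)"
      and best: "is_pair (s' 2) \<Longrightarrow>
        \<exists>r l u. s' 2 = Pair (Num (r, l)) u \<and> l \<le> vsize L \<and> test r \<and> r \<in> set xs"
      and pend: "m \<in> set zs \<or> (\<exists>l u. s' 2 = Pair (Num (m, l)) u)"
      unfolding I_def by blast
    have "zs = []"
      using strip_not_pair[OF zs] A by blast
    with pend obtain l u where "s' 2 = Pair (Num (m, l)) u"
      by auto
    with best have "s' 2 = Pair (Num (m, l)) u" "l \<le> vsize L"
      by auto
    then show "runs kB Q (Head 0 2) s' (\<lambda>u s'. t + u \<le> 2 + vsize L * (3 * vsize L + K + 16) \<and>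
        (\<exists>l \<le> vsize L. s' 0 = Num (m, l)))"
      using A by (simp add: algebra_simps)
  qed
qed

lemma MFE_reduction:
  assumes lev: "admits_candidate_levels kB \<T> \<Omega> M" and "structures_of_interest \<Omega>"
    and d: "\<And>Q s T g l. oracle_for Q B \<Longrightarrow> s \<in> inputs \<Longrightarrow> T \<in> \<T> \<Longrightarrow>
      runs kB Q d (init (Pair (Num (g, l)) (load (inst s T))))
        (\<lambda>t s'. is_pair (s' 0) = test s T g \<and> t \<le> l + (vsize (load (inst s T)) + 20))"
    and test: "\<And>s T. s \<in> inputs \<Longrightarrow> T \<in> \<T> \<Longrightarrow> test s T (mfe \<Omega> M s T)"
      "\<And>s T g. s \<in> inputs \<Longrightarrow> T \<in> \<T> \<Longrightarrow> test s T g \<Longrightarrow> mfe \<Omega> M s T \<le> g"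
  shows "poly_time_turing_reduction kB (MFE \<T> \<Omega> M) B"
proof -
  obtain c h where h: "poly_bounded h"
    and c: "\<And>Q s T. s \<in> inputs \<Longrightarrow> T \<in> \<T> \<Longrightarrow>
      runs kB Q c (init (load (inst s T)))
        (\<lambda>t s'. t \<le> h (vsize (load (inst s T))) \<and> vsize (s' 0) \<le> h (vsize (load (inst s T))) \<and>
           (\<exists>xs. strip (s' 0) = enc_list (map Num xs) \<and> (\<lambda>S. M s S T) ` \<Omega> s \<subseteq> set xs))"
    by (rule levels_program[OF lev]) (assumption | rule that)+
  define p where "p = Seq (Call 1 c 0) (Seq (While 1 (min_body d)) (Head 0 2))"
  define f where "f n = 3 + h n + h n * (3 * h n + (n + 20) + 16) + h n" for n
  have "solves_in_time kB Q p (MFE \<T> \<Omega> M) f" if Q: "oracle_for Q B" for Q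
    unfolding solves_in_time_def runs_def[symmetric]
  proof
    fix x assume "x \<in> Domain (MFE \<T> \<Omega> M)"
    then obtain s T where x: "x = inst s T" and sT: "s \<in> inputs" "T \<in> \<T>"
      by (auto simp: MFE_def)
    have in_MFE: "(x, y) \<in> MFE \<T> \<Omega> M \<longleftrightarrow> y = Num (mfe \<Omega> M s T)" for y
      using sT unfolding x MFE_def by auto
    have mem: "mfe \<Omega> M s T \<in> (\<lambda>S. M s S T) ` \<Omega> s"
      unfolding mfe_def using finite_structures_of_interest[OF assms(2) sT(1)]
      by (intro Min_in) auto
    let ?n = "vsize (load x)"
    show "runs kB Q p (init (load x))
      (\<lambda>t s'. (x, strip (s' 0)) \<in> MFE \<T> \<Omega> M \<and> t + vsize (s' 0) \<le> f ?n)"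
      unfolding p_def in_MFE runs_Seq[of _ _ "Call 1 c 0"] runs_Call init_simps
      unfolding x
    proof (rule runs_mono[OF c[OF sT]], elim conjE exE)
      fix t xs and s' :: store
      let ?n = "vsize (load (inst s T))"
      let ?L = "s' 0"
      assume t: "t \<le> h ?n" and L: "vsize ?L \<le> h ?n"
        and xs: "strip ?L = enc_list (map Num xs)" "(\<lambda>S. M s S T) ` \<Omega> s \<subseteq> set xs"
      have "vsize ?L * (3 * vsize ?L + (?n + 20) + 16) \<le> h ?n * (3 * h ?n + (?n + 20) + 16)"
        using L by (intro mult_mono) auto
      then show "runs kB Q (Seq (While 1 (min_body d)) (Head 0 2)) ((init (load (inst s T)))(1 := ?L))
          (\<lambda>u s''. strip (s'' 0) = Num (mfe \<Omega> M s T) \<and> 1 + t + u + vsize (s'' 0) \<le> f ?n)"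
        using t L mem xs(2)
        by (intro runs_mono[OF runs_min_loop[where test = "test s T" and m = "mfe \<Omega> M s T",
              OF d[OF Q sT] xs(1)]])
          (auto simp: f_def test sT)
    qed
  qed
  moreover have "poly_bounded f"
    unfolding f_def by (intro poly_bounded_intros h)
  ultimately show ?thesis
    unfolding poly_time_turing_reduction_def by blast
qed

lemma MFE_reduces_to_dMFE:
  assumes "admits_candidate_levels kB \<T> \<Omega> M" and "structures_of_interest \<Omega>"
  shows "poly_time_turing_reduction kB (MFE \<T> \<Omega> M) (dMFE \<T> \<Omega> M)"
proof (rule MFE_reduction[OF assms, where test = "\<lambda>s T g. mfe \<Omega> M s T \<le> g" and d = "Oracle 0 0"])
  fix Q s T g l
  assume "oracle_for Q (dMFE \<T> \<Omega> M)" "s \<in> inputs" "T \<in> \<T>"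
  note Q = oracle_dMFE[OF this]
  show "runs kB Q (Oracle 0 0) (init (Pair (Num (g, l)) (load (inst s T))))
     (\<lambda>t s'. is_pair (s' 0) = (mfe \<Omega> M s T \<le> g) \<and> t \<le> l + (vsize (load (inst s T)) + 20))"
    using vsize_load_enc_bool[of "mfe \<Omega> M s T \<le> g"]
    by (simp add: strip_query Q del: strip_simps)
qed auto

lemma MFE_reduces_to_SSEL:
  assumes "admits_candidate_levels kB \<T> \<Omega> M" and "structures_of_interest \<Omega>"
  shows "poly_time_turing_reduction kB (MFE \<T> \<Omega> M) (SSEL \<T> \<Omega> M)"
proof (rule MFE_reduction[OF assms, where test = "\<lambda>s T g. g \<in> (\<lambda>S. M s S T) ` \<Omega> s"
      and d = "Seq (Oracle 0 0) (Seq (Const 1 1) (IfLe 1 0 (MkPair 0 0 0) (SetLeaf 0)))"])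
  fix Q s T g l
  assume sT: "oracle_for Q (SSEL \<T> \<Omega> M)" "s \<in> inputs" "T \<in> \<T>"
  note Q = oracle_SSEL[OF sT]
  have "1 \<le> real (num_ssel \<Omega> M s T g) \<longleftrightarrow> g \<in> (\<lambda>S. M s S T) ` \<Omega> s"
    using num_ssel_pos_iff[of \<Omega> s M T g] finite_structures_of_interest(1)[OF assms(2) sT(2)] by simp
  then show "runs kB Q (Seq (Oracle 0 0) (Seq (Const 1 1) (IfLe 1 0 (MkPair 0 0 0) (SetLeaf 0))))
        (init (Pair (Num (g, l)) (load (inst s T))))
     (\<lambda>t s'. is_pair (s' 0) = (g \<in> (\<lambda>S. M s S T) ` \<Omega> s) \<and>
        t \<le> l + (vsize (load (inst s T)) + 20))"
    by (simp add: strip_query Q del: strip_simps)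
next
  fix s T assume "s \<in> inputs"
  note fin = finite_structures_of_interest[OF assms(2) this]
  then show "mfe \<Omega> M s T \<in> (\<lambda>S. M s S T) ` \<Omega> s"
    unfolding mfe_def by (intro Min_in) auto
  show "mfe \<Omega> M s T \<le> g" if "g \<in> (\<lambda>S. M s S T) ` \<Omega> s" for g
    unfolding mfe_def using fin that by (intro Min_le) auto
qed

section \<open>Summing over the distinct levels\<close>

text \<open>The list of levels may contain repetitions, so a level is counted only at its last
  occurrence, when it is not a member of the rest of the list.\<close>

definition member_body :: com where
  "member_body = Seq (Head 3 2) (Seq (Tail 2 2)
     (IfLe 1 3 (IfLe 3 1 (MkPair 0 1 1) Skip) Skip))"

definition member_com :: com where
  "member_com = Seq (Head 1 0) (Seq (Tail 2 0) (Seq (SetLeaf 0) (While 2 member_body)))"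

lemma runs_member_com:
  assumes w: "strip w = enc_list (map Num ys)"
  shows "runs kB Q member_com (init (Pair (Num (g, l)) w))
    (\<lambda>t s'. is_pair (s' 0) = (g \<in> set ys) \<and> t \<le> 4 + vsize w * (2 * l + 2 * vsize w + 7))"
proof -
  define I :: "store \<Rightarrow> bool" where "I s \<longleftrightarrow> s 1 = Num (g, l) \<and> vsize (s 2) \<le> vsize w \<and>
    (\<exists>zs. strip (s 2) = enc_list (map Num zs) \<and> (is_pair (s 0) \<or> g \<in> set zs) = (g \<in> set ys))" for s
  let ?B = "2 * l + 2 * vsize w + 6"
  have step: "runs kB Q member_body s (\<lambda>t s'. t \<le> ?B \<and> I s' \<and> vsize (s' 2) < vsize (s 2))"
    if "I s" "is_pair (s 2)" for s
  proof -
    from \<open>I s\<close> obtain zs where s: "s 1 = Num (g, l)" "vsize (s 2) \<le> vsize w"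
      and zs: "strip (s 2) = enc_list (map Num zs)" "(is_pair (s 0) \<or> g \<in> set zs) = (g \<in> set ys)"
      unfolding I_def by blast
    from strip_is_pairE[OF zs(1) \<open>is_pair (s 2)\<close>] obtain g' l' w' ys' where
      "s 2 = Pair (Num (g', l')) w'" "zs = g' # ys'" "strip w' = enc_list (map Num ys')" .
    with s zs(2) show ?thesis
      by (auto simp: member_body_def I_def)
  qed
  let ?s = "(init (Pair (Num (g, l)) w))(1 := Num (g, l), 2 := w, 0 := Leaf)"
  have start: "I ?s"
    using w by (auto simp: I_def)
  have "runs kB Q (While 2 member_body) ?s
      (\<lambda>t s'. is_pair (s' 0) = (g \<in> set ys) \<and> 3 + t \<le> 4 + vsize w * (2 * l + 2 * vsize w + 7))"
  proof (rule runs_mono[OF runs_While[where I = I and B = ?B]], rule step, assumption, assumption,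
      rule start, elim conjE)
    fix t s' assume t: "t \<le> 1 + vsize (?s 2) * (?B + 1)" and "I s'" "\<not> is_pair (s' 2)"
    then have "is_pair (s' 0) = (g \<in> set ys)"
      unfolding I_def using strip_not_pair by fastforce
    with t show "is_pair (s' 0) = (g \<in> set ys) \<and> 3 + t \<le> 4 + vsize w * (2 * l + 2 * vsize w + 7)"
      by (simp add: add.commute add.left_commute)
  qed
  then show ?thesis
    by (simp add: member_com_def numeral_3_eq_3)
qed

text \<open>Variable 0 holds the instance, 1 the levels not yet scanned, and 2 the partial sum.\<close>

definition sum_body :: com where
  "sum_body = Seq (Head 3 1) (Seq (Tail 1 1) (Seq (MkPair 4 3 1) (Seq (Call 5 member_com 4)
     (IfPair 5 Skip
       (Seq (MkPair 6 3 0) (Seq (Oracle 7 6)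
       (Seq (Const 8 0) (Seq (Arith Sub 8 8 3)
       (Seq (LoadKB 9) (Seq (Tail 10 0) (Seq (Arith Mul 9 9 10)
       (Seq (Arith Div 8 8 9) (Seq (ExpOf 8 8)
       (Seq (Arith Mul 7 7 8) (Arith Add 2 2 7)))))))))))))))"

lemma runs_sum_loop:
  assumes Q: "\<And>k. Q (inst_k s T k) = Num (cnt k)"
    and L: "strip L = enc_list (map Num xs)"
  defines "v \<equiv> load (inst s T)"
  shows "runs kB Q (While 1 sum_body) ((init v)(1 := L, 2 := Num (0, 1)))
      (\<lambda>t s'. t \<le> 1 + vsize L * (vsize L * (4 * vsize L + 7) + 100 * vsize L + vsize v + 100) \<and>
         (\<exists>a \<le> 1 + 10 * vsize L. s' 2 = Num (\<Sum>g\<in>set xs. cnt g * exp (- g / (kB * T)), a)))"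
proof -
  \<comment> \<open>Adding the term of a level of size \<open>l\<close> enlarges the accumulated expression by \<open>10 + l\<close>, while the
    list shrinks by \<open>1 + l\<close>; hence the factor 10 in the invariant.\<close>
  let ?term = "\<lambda>g. cnt g * exp (- g / (kB * T))"
  define I :: "store \<Rightarrow> bool" where "I st \<longleftrightarrow> st 0 = v \<and> vsize (st 1) \<le> vsize L \<and>
    (\<exists>zs a. strip (st 1) = enc_list (map Num zs) \<and> set zs \<subseteq> set xs \<and>
      st 2 = Num (sum ?term (set xs - set zs), a) \<and> a + 10 * vsize (st 1) \<le> 1 + 10 * vsize L)" for st
  define Y where "Y = vsize L * (4 * vsize L + 7)"
  let ?B = "Y + 100 * vsize L + vsize v + 99"
  have step: "runs kB Q sum_body st (\<lambda>t s'. t \<le> ?B \<and> I s' \<and> vsize (s' 1) < vsize (st 1))"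
    if "I st" "is_pair (st 1)" for st
  proof -
    from \<open>I st\<close> obtain zs a where s0: "st 0 = v" and vs: "vsize (st 1) \<le> vsize L"
      and zs: "strip (st 1) = enc_list (map Num zs)" "set zs \<subseteq> set xs"
      and acc: "st 2 = Num (sum ?term (set xs - set zs), a)" "a + 10 * vsize (st 1) \<le> 1 + 10 * vsize L"
      unfolding I_def by blast
    from strip_is_pairE[OF zs(1) \<open>is_pair (st 1)\<close>] obtain g l w ys where
      g: "st 1 = Pair (Num (g, l)) w" "zs = g # ys" "strip w = enc_list (map Num ys)" .
    have gx: "g \<in> set xs" "set ys \<subseteq> set xs" and sz: "1 + l + vsize w \<le> vsize L"
      using zs(2) vs g by auto
    have tl: "tl_val v = Num (T, 1)"
      by (simp add: v_def inst_def)
    have qry: "Q (Pair (Num g) (strip v)) = Num (cnt g)"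
      using Q[of g] by (simp add: v_def inst_k_def)
    have mem: "runs kB Q member_com (init (Pair (Num (g, l)) w))
        (\<lambda>t s'. is_pair (s' 0) = (g \<in> set ys) \<and> t \<le> 4 + Y)"
    proof (rule runs_mono[OF runs_member_com[OF g(3)]])
      have "vsize w * (2 * l + 2 * vsize w + 7) \<le> Y"
        unfolding Y_def using sz by (intro mult_mono) auto
      then show "is_pair (s' 0) = (g \<in> set ys) \<and> t \<le> 4 + Y"
        if "is_pair (s' 0) = (g \<in> set ys) \<and> t \<le> 4 + vsize w * (2 * l + 2 * vsize w + 7)" for t s'
        using that by linarith
    qed
    have new: "sum ?term (set xs - set ys) = sum ?term (set xs - set zs) + ?term g"
      if "g \<notin> set ys"
    proof -
      have ins: "set xs - set ys = insert g (set xs - set zs)" and "g \<notin> set xs - set zs"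
        using gx that g(2) by auto
      then show ?thesis
        unfolding ins by (subst sum.insert) auto
    qed
    have old: "set xs - set ys = set xs - set zs" if "g \<in> set ys"
      using that g(2) by auto
    have I_intro: "I st'"
      if "st' 0 = v" "st' 1 = w" "st' 2 = Num (sum ?term (set xs - set ys), a')"
        "a' + 10 * vsize w \<le> 1 + 10 * vsize L" for st' a'
      unfolding I_def using that gx(2) g(3) sz by auto
    have acc': "a + 10 * (1 + l + vsize w) \<le> 1 + 10 * vsize L"
      using acc(2) g(1) by simp
    have "runs kB Q sum_body st (\<lambda>t s'. t \<le> ?B \<and> I s' \<and> s' 1 = w)"
    proof (cases "g \<in> set ys")
      case True
      show ?thesis
        unfolding sum_body_def using g(1)
        apply simp
        apply (rule runs_mono[OF mem])
        using True s0 acc(1) acc'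
        apply simp
        apply (rule I_intro[where a' = a])
        apply (simp_all add: old)
        done
    next
      case False
      show ?thesis
        unfolding sum_body_def using g(1)
        apply simp
        apply (rule runs_mono[OF mem])
        using False sz s0 acc(1) acc'
        apply (simp add: tl qry)
        apply (rule I_intro[where a' = "a + 10 + l"])
        using new[OF False] apply simp_all
        done
    qed
    then show ?thesis
      by (rule runs_mono) (use g(1) in simp)
  qed
  have start: "I ((init v)(1 := L, 2 := Num (0, 1)))"
    using L by (auto simp: I_def)
  show ?thesis
  proof (rule runs_mono[OF runs_While[where I = I and B = ?B]], rule step, assumption, assumption,
      rule start, elim conjE)
    fix t s'
    assume t: "t \<le> 1 + vsize (((init v)(1 := L, 2 := Num (0, 1))) 1) * (?B + 1)"
      and "I s'" and np: "\<not> is_pair (s' 1)"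
    then obtain zs a where zs: "strip (s' 1) = enc_list (map Num zs)"
      and acc: "s' 2 = Num (sum ?term (set xs - set zs), a)" "a + 10 * vsize (s' 1) \<le> 1 + 10 * vsize L"
      unfolding I_def by blast
    have "zs = []"
      using strip_not_pair[OF zs np] .
    with t acc show "t \<le> 1 + vsize L * (vsize L * (4 * vsize L + 7) + 100 * vsize L + vsize v + 100) \<and>
         (\<exists>a \<le> 1 + 10 * vsize L. s' 2 = Num (sum ?term (set xs), a))"
      by (simp add: Y_def add.commute add.left_commute)
  qed
qed

lemma PF_reduces_to_SSEL:
  assumes lev: "admits_candidate_levels kB \<T> \<Omega> M" and "structures_of_interest \<Omega>"
  shows "poly_time_turing_reduction kB (PF kB \<T> \<Omega> M) (SSEL \<T> \<Omega> M)"
proof -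
  obtain c h where h: "poly_bounded h"
    and c: "\<And>Q s T. s \<in> inputs \<Longrightarrow> T \<in> \<T> \<Longrightarrow>
      runs kB Q c (init (load (inst s T)))
        (\<lambda>t s'. t \<le> h (vsize (load (inst s T))) \<and> vsize (s' 0) \<le> h (vsize (load (inst s T))) \<and>
           (\<exists>xs. strip (s' 0) = enc_list (map Num xs) \<and> (\<lambda>S. M s S T) ` \<Omega> s \<subseteq> set xs))"
    by (rule levels_program[OF lev]) (assumption | rule that)+
  define p where
    "p = Seq (Call 1 c 0) (Seq (Const 2 0) (Seq (While 1 sum_body) (Copy 0 2)))"
  define f where
    "f n = 5 + h n + h n * (h n * (4 * h n + 7) + 100 * h n + n + 100) + 10 * h n" for n
  have "solves_in_time kB Q p (PF kB \<T> \<Omega> M) f" if Q: "oracle_for Q (SSEL \<T> \<Omega> M)" for Q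
    unfolding solves_in_time_def runs_def[symmetric]
  proof
    fix x assume "x \<in> Domain (PF kB \<T> \<Omega> M)"
    then obtain s T where x: "x = inst s T" and sT: "s \<in> inputs" "T \<in> \<T>"
      by (auto simp: PF_def)
    have in_PF: "(x, y) \<in> PF kB \<T> \<Omega> M \<longleftrightarrow> y = Num (pf kB \<Omega> M s T)" for y
      using sT unfolding x PF_def by auto
    have fin: "finite (\<Omega> s)"
      using finite_structures_of_interest[OF assms(2) sT(1)] by blast
    let ?n = "vsize (load x)"
    show "runs kB Q p (init (load x))
      (\<lambda>t s'. (x, strip (s' 0)) \<in> PF kB \<T> \<Omega> M \<and> t + vsize (s' 0) \<le> f ?n)"
      unfolding p_def in_PF runs_Seq[of _ _ "Call 1 c 0"] runs_Call init_simps
      unfolding x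
    proof (rule runs_mono[OF c[OF sT]], elim conjE exE)
      fix t xs and s' :: store
      let ?n = "vsize (load (inst s T))"
      let ?L = "s' 0"
      assume t: "t \<le> h ?n" and L: "vsize ?L \<le> h ?n"
        and xs: "strip ?L = enc_list (map Num xs)" "(\<lambda>S. M s S T) ` \<Omega> s \<subseteq> set xs"
      have pf: "pf kB \<Omega> M s T =
          (\<Sum>g\<in>set xs. real (num_ssel \<Omega> M s T g) * exp (- g / (kB * T)))"
        using fin xs(2) by (intro pf_eq_sum_levels) auto
      have bound: "vsize ?L * (vsize ?L * (4 * vsize ?L + 7) + 100 * vsize ?L + ?n + 100)
          \<le> h ?n * (h ?n * (4 * h ?n + 7) + 100 * h ?n + ?n + 100)"
        using L by (intro mult_mono add_mono) auto
      have "runs kB Q (While 1 sum_body) ((init (load (inst s T)))(1 := ?L, 2 := Num (0, 1)))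
          (\<lambda>u s''. fst (num_of (s'' 2)) = pf kB \<Omega> M s T \<and> s'' 2 = Num (num_of (s'' 2)) \<and>
             1 + t + (1 + (u + 1)) + vsize (s'' 2) \<le> f ?n)"
        using t L bound
        by (intro runs_mono[OF runs_sum_loop[where cnt = "\<lambda>k. real (num_ssel \<Omega> M s T k)",
              OF oracle_SSEL[OF Q sT] xs(1)]])
          (auto simp: f_def pf)
      then show "runs kB Q (Seq (Const 2 0) (Seq (While 1 sum_body) (Copy 0 2)))
          ((init (load (inst s T)))(1 := ?L))
          (\<lambda>u s''. strip (s'' 0) = Num (pf kB \<Omega> M s T) \<and> 1 + t + u + vsize (s'' 0) \<le> f ?n)"
        unfolding runs_Seq runs_atomic of_int_0
      proof (rule runs_mono, elim conjE, goal_cases)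
        case (1 u s'')
        then show ?case by (cases "s'' 2") auto
      qed
    qed
  qed
  moreover have "poly_bounded f"
    unfolding f_def by (intro poly_bounded_intros h)
  ultimately show ?thesis
    unfolding poly_time_turing_reduction_def by blast
qed

theorem theorem20:
  fixes kB :: real and \<T> :: "real set"
    and \<Omega> :: "strands \<Rightarrow> sstructure set" and M :: energy_model
  assumes "kB > 0"
    and "\<T> \<subseteq> {0<..}"
    and "structures_of_interest \<Omega>"
    and "admits_candidate_levels kB \<T> \<Omega> M"
  shows "poly_time_turing_reduction kB (dMFE \<T> \<Omega> M) (MFE \<T> \<Omega> M)
       \<and> poly_time_turing_reduction kB (dPF kB \<T> \<Omega> M) (PF kB \<T> \<Omega> M)
       \<and> poly_time_turing_reduction kB (MFE \<T> \<Omega> M) (dMFE \<T> \<Omega> M)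
       \<and> poly_time_turing_reduction kB (MFE \<T> \<Omega> M) (SSEL \<T> \<Omega> M)
       \<and> poly_time_turing_reduction kB (PF kB \<T> \<Omega> M) (SSEL \<T> \<Omega> M)"
  by (intro conjI dMFE_reduces_to_MFE dPF_reduces_to_PF MFE_reduces_to_dMFE MFE_reduces_to_SSEL
      PF_reduces_to_SSEL assms)

end
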